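(* Let $Z$ be a non-trivial real locally convex linear space and $C \subseteq Z$ a convex cone with $0 \in C \neq Z$. If $\mathcal A \subseteq \mathcal G(Z, C)$ then $$\forall z^* \in C^+\setminus\{0\}\colon \quad \sigma^{\vartriangle}_{\inf \mathcal A}(z^* ) = \inf\{\sigma^{\vartriangle}_A(z^* ) \mid A \in \mathcal A\},$$ $$\forall z^* \in C^+\setminus\{0\}\colon \quad \sigma^{\vartriangle}_{\sup \mathcal A}(z^* ) \geq \sup\{\sigma^{\vartriangle}_A(z^* ) \mid A \in \mathcal A\}.$$ Moreover, $$\inf \mathcal A = \bigcap_{z^*\in C^+\setminus\{0\}}\{z \in Z \mid \inf\{\sigma^{\vartriangle}_A(z^* ) \mid A \in \mathcal A\} \leq z^*(z)\},$$ $$\sup \mathcal A = \bigcap_{z^*\in C^+\setminus\{0\}}\{z \in Z \mid \sup\{\sigma^{\vartriangle}_A(z^* ) \mid A \in \mathcal A\} \leq z^*(z)\}.$$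
   Context: A set $C$ is a cone if $z\in C$, $t>0$ imply $tz\in C$. $Z^*$ is the topological dual of $Z$, and $C^+ = \{z^* \in Z^* \mid \forall z \in C\colon z^*(z)\ge 0\}$. $\mathcal G(Z,C) = \{A \subseteq Z \mid A = \operatorname{cl}\operatorname{co}(A+C)\}$ (Minkowski addition, $\emptyset + C = \emptyset$, so $\emptyset, Z\in\mathcal G(Z,C)$). It is a complete lattice with respect to the partial order $\supseteq$, with $\inf \mathcal A = \operatorname{cl}\operatorname{co}\bigcup_{A \in \mathcal A} A$ and $\sup\mathcal A = \bigcap_{A\in\mathcal A} A$ (and $\inf\mathcal A = \emptyset$, $\sup \mathcal A = Z$ if $\mathcal A=\emptyset$). For $A \subseteq Z$, the function $\sigma^{\vartriangle}_A \colon Z^* \to \mathbb R\cup\{\pm\infty\}$ is $\sigma^{\vartriangle}_A(z^* ) = \inf_{a \in A} z^*(a)$, with $\inf\emptyset=+\infty$, $\sup\emptyset=-\infty$ in the extended reals.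
   Formalization: The two "Moreover" identities are stated only when C^+\{0} is non-empty; without this they fail: for C a dense proper linear subspace, C^+={0} and the empty intersections equal Z, while inf and sup of the family {∅} are ∅. *)

theory Defs
  imports "HOL-Analysis.Analysis"
begin

text \<open>Real topological vector spaces; as in the general theory, no separation axiom is imposed.\<close>

class topological_real_vector = topological_ab_group_add + real_vector +
  assumes tendsto_scaleR_Pair:
    "LIM x (nhds a \<times>\<^sub>F nhds b). fst x *\<^sub>R snd x :> nhds (a *\<^sub>R b)"

text \<open>The constant \<open>convex\<close> cannot be used inside the class specification, so it is unfolded here.\<close>

class locally_convex_space = topological_real_vector +
  assumes convex_nhds_zero_raw:
    "open U \<Longrightarrow> 0 \<in> U \<Longrightarrow> \<exists>V. open V \<and> 0 \<in> V \<and> V \<subseteq> U \<and>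
      (\<forall>x\<in>V. \<forall>y\<in>V. \<forall>u\<ge>0. \<forall>v\<ge>0. u + v = 1 \<longrightarrow> u *\<^sub>R x + v *\<^sub>R y \<in> V)"

lemma convex_nhds_zero:
  fixes U :: "'z::locally_convex_space set"
  assumes "open U" "0 \<in> U"
  obtains V where "open V" "convex V" "0 \<in> V" "V \<subseteq> U"
  using convex_nhds_zero_raw[OF assms] unfolding convex_def by blast

instance real_normed_vector \<subseteq> locally_convex_space
proof
  show "LIM x (nhds a \<times>\<^sub>F nhds b). fst x *\<^sub>R snd x :> nhds (a *\<^sub>R b)" for a and b :: 'a
    by (intro tendsto_scaleR filterlim_fst filterlim_snd)
  show "\<exists>V. open V \<and> 0 \<in> V \<and> V \<subseteq> U \<and>
      (\<forall>x\<in>V. \<forall>y\<in>V. \<forall>u\<ge>0. \<forall>v\<ge>0. u + v = 1 \<longrightarrow> u *\<^sub>R x + v *\<^sub>R y \<in> V)" if "open U" "0 \<in> U" for U :: "'a set"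
    using that unfolding convex_def[symmetric] by (metis centre_in_ball convex_ball open_ball open_contains_ball)
qed

text \<open>Unlike the library's \<open>cone\<close>, only strictly positive multiples are required.\<close>

definition is_cone :: "'z::real_vector set \<Rightarrow> bool" where
  "is_cone C \<longleftrightarrow> (\<forall>z\<in>C. \<forall>t>0. t *\<^sub>R z \<in> C)"

definition top_dual :: "('z::topological_real_vector \<Rightarrow> real) set" where
  "top_dual = {f. linear f \<and> continuous_on UNIV f}"

definition dual_cone :: "'z::topological_real_vector set \<Rightarrow> ('z \<Rightarrow> real) set" where
  "dual_cone C = {f \<in> top_dual. \<forall>z\<in>C. f z \<ge> 0}"

text \<open>\<open>A + C\<close> is the Minkowski sum from \<open>HOL-Library.Set_Algebras\<close>; it is empty if \<open>A\<close> is.\<close>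

definition GG :: "'z::topological_real_vector set \<Rightarrow> 'z set set" where
  "GG C = {A. A = closure (convex hull (A + C))}"

text \<open>Infimum and supremum of families in \<open>GG C\<close> with respect to \<open>\<supseteq>\<close>.\<close>

definition G_inf :: "'z::topological_real_vector set set \<Rightarrow> 'z set" where
  "G_inf \<A> = closure (convex hull (\<Union>\<A>))"

definition G_sup :: "'z::topological_real_vector set set \<Rightarrow> 'z set" where
  "G_sup \<A> = \<Inter>\<A>"

definition sigma_tri :: "'z set \<Rightarrow> ('z \<Rightarrow> real) \<Rightarrow> ereal" where
  "sigma_tri A f = (INF a\<in>A. ereal (f a))"

subsection \<open>\<open>G_inf\<close> and \<open>G_sup\<close> are the lattice operations of \<open>(GG C, \<supseteq>)\<close>\<close>

lemma continuous_on_add_right: "continuous_on UNIV (\<lambda>x::'z::topological_real_vector. x + c)"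
  unfolding continuous_on_def by (auto intro!: tendsto_intros)

lemma tendsto_scaleR':
  fixes g :: "'b \<Rightarrow> 'z::topological_real_vector"
  assumes "(f \<longlongrightarrow> a) F" "(g \<longlongrightarrow> b) F"
  shows "((\<lambda>x. f x *\<^sub>R g x) \<longlongrightarrow> a *\<^sub>R b) F"
  using filterlim_compose[OF tendsto_scaleR_Pair, of "\<lambda>x. (f x, g x)" a b F] assms
  by (simp add: nhds_prod[symmetric] tendsto_Pair)

lemma convex_closure_tvs:
  fixes S :: "'z::topological_real_vector set"
  assumes "convex S" shows "convex (closure S)"
proof (rule convexI)
  fix x y :: 'z and u v :: real
  assume xy: "x \<in> closure S" "y \<in> closure S" and uv: "u \<ge> 0" "v \<ge> 0" "u + v = 1"
  have c: "continuous_on UNIV (\<lambda>p::'z \<times> 'z. u *\<^sub>R fst p + v *\<^sub>R snd p)"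
    unfolding continuous_on_def
    by (intro ballI tendsto_add tendsto_scaleR' tendsto_const tendsto_fst tendsto_snd tendsto_ident_at)
  have "(\<lambda>p. u *\<^sub>R fst p + v *\<^sub>R snd p) ` closure (S \<times> S) \<subseteq> closure S"
    by (rule image_closure_subset[OF continuous_on_subset[OF c]])
      (use assms uv closure_subset in \<open>auto simp: convex_def intro!: subsetD[OF closure_subset]\<close>)
  with xy show "u *\<^sub>R x + v *\<^sub>R y \<in> closure S"
    by (auto simp: closure_Times image_subset_iff)
qed

lemma GG_iff:
  fixes C :: "'z::topological_real_vector set"
  assumes "0 \<in> C"
  shows "A \<in> GG C \<longleftrightarrow> closed A \<and> convex A \<and> A + C \<subseteq> A"
proof
  assume "A \<in> GG C"
  then have A: "A = closure (convex hull (A + C))" by (simp add: GG_def)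
  have "A + C \<subseteq> closure (convex hull (A + C))"
    by (meson closure_subset hull_subset order_trans)
  then show "closed A \<and> convex A \<and> A + C \<subseteq> A"
    using A by (metis closed_closure convex_closure_tvs convex_convex_hull)
next
  assume *: "closed A \<and> convex A \<and> A + C \<subseteq> A"
  have "A \<subseteq> A + C" using assms by (metis add.right_neutral set_plus_intro subsetI)
  with * have "A + C = A" by blast
  with * show "A \<in> GG C" by (simp add: GG_def hull_same)
qed

lemma G_sup_lub:
  assumes "0 \<in> C" "\<A> \<subseteq> GG C"
  shows "G_sup \<A> \<in> GG C" "A \<in> \<A> \<Longrightarrow> A \<supseteq> G_sup \<A>"
    "(\<And>A. A \<in> \<A> \<Longrightarrow> A \<supseteq> B) \<Longrightarrow> G_sup \<A> \<supseteq> B"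
proof -
  have A: "closed A" "convex A" "A + C \<subseteq> A" if "A \<in> \<A>" for A
    using subsetD[OF assms(2) that] unfolding GG_iff[OF assms(1)] by blast+
  have "\<Inter>\<A> + C \<subseteq> \<Inter>\<A>"
    using A(3) by (fastforce elim!: set_plus_elim intro: set_plus_intro)
  then show "G_sup \<A> \<in> GG C"
    using A unfolding G_sup_def GG_iff[OF assms(1)] by (auto intro: convex_Inter)
qed (auto simp: G_sup_def)

lemma G_inf_glb:
  assumes "0 \<in> C" "\<A> \<subseteq> GG C"
  shows "G_inf \<A> \<in> GG C" "A \<in> \<A> \<Longrightarrow> G_inf \<A> \<supseteq> A"
    "B \<in> GG C \<Longrightarrow> (\<And>A. A \<in> \<A> \<Longrightarrow> B \<supseteq> A) \<Longrightarrow> B \<supseteq> G_inf \<A>"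
proof -
  have A: "A + C \<subseteq> A" if "A \<in> \<A>" for A
    using subsetD[OF assms(2) that] unfolding GG_iff[OF assms(1)] by blast+
  have sub: "x + c \<in> convex hull (\<Union>\<A>)" if "c \<in> C" "x \<in> convex hull (\<Union>\<A>)" for x c
  proof -
    have "(\<lambda>x. c + x) ` (\<Union>\<A>) \<subseteq> \<Union>\<A>"
      using A that(1) by (fastforce intro: set_plus_intro simp: add.commute)
    then have "convex hull ((\<lambda>x. c + x) ` (\<Union>\<A>)) \<subseteq> convex hull (\<Union>\<A>)"
      by (rule hull_mono)
    then show ?thesis using that(2) unfolding convex_hull_translation
      by (auto simp: add.commute image_subset_iff)
  qed
  have "x + c \<in> G_inf \<A>" if "c \<in> C" "x \<in> G_inf \<A>" for x c
  proof -
    have "(\<lambda>x. x + c) ` closure (convex hull (\<Union>\<A>)) \<subseteq> closure (convex hull (\<Union>\<A>))"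
      by (rule image_closure_subset[OF continuous_on_subset[OF continuous_on_add_right]])
        (use sub[OF that(1)] closure_subset in auto)
    then show ?thesis using that(2) by (auto simp: G_inf_def)
  qed
  then show "G_inf \<A> \<in> GG C"
    unfolding GG_iff[OF assms(1)]
    by (auto simp: G_inf_def convex_closure_tvs elim!: set_plus_elim)
  show "A \<in> \<A> \<Longrightarrow> G_inf \<A> \<supseteq> A"
    unfolding G_inf_def by (meson Union_upper closure_subset hull_subset order_trans)
  show "B \<in> GG C \<Longrightarrow> (\<And>A. A \<in> \<A> \<Longrightarrow> B \<supseteq> A) \<Longrightarrow> B \<supseteq> G_inf \<A>"
    unfolding GG_iff[OF assms(1)] G_inf_def
    by (intro closure_minimal hull_minimal) auto
qed

end

theory Submission
  imports Defs
begin

text \<open>The identities for the infimum and the supremum follow from the separation of a point from a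
  nonempty closed convex set; a separating functional of a set in \<open>GG C\<close> is bounded below on a
  translate of \<open>C\<close> and hence lies in \<open>dual_cone C\<close>. Separation itself rests on the following form of
  the Hahn--Banach theorem: below every sublinear functional there is, by Zorn's lemma, a minimal
  one, and minimal sublinear functionals are linear.\<close>

section \<open>Sublinear functionals and the Hahn--Banach theorem\<close>

definition sublinear :: "('a::real_vector \<Rightarrow> real) \<Rightarrow> bool" where
  "sublinear p \<longleftrightarrow> (\<forall>x y. p (x + y) \<le> p x + p y) \<and> (\<forall>x. \<forall>t>0. p (t *\<^sub>R x) = t * p x)"

text \<open>Applying the inequality to \<open>1 / t\<close> and \<open>t *\<^sub>R x\<close> yields
  the reverse one.\<close>

lemma sublinearI:
  fixes p :: "'a::real_vector \<Rightarrow> real"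
  assumes "\<And>x y. p (x + y) \<le> p x + p y"
    and le: "\<And>x t. t > 0 \<Longrightarrow> p (t *\<^sub>R x) \<le> t * p x"
  shows "sublinear p"
  unfolding sublinear_def
proof (intro conjI allI impI)
  fix x :: 'a and t :: real
  assume t: "t > 0"
  have "p ((1 / t) *\<^sub>R t *\<^sub>R x) \<le> (1 / t) * p (t *\<^sub>R x)"
    using t by (intro le) simp
  then have "t * p x \<le> p (t *\<^sub>R x)"
    using t by (simp add: field_simps)
  then show "p (t *\<^sub>R x) = t * p x"
    using le[OF t, of x] by simp
qed (use assms(1) in simp)

lemma sublinear_add: "sublinear p \<Longrightarrow> p (x + y) \<le> p x + p y"
  by (simp add: sublinear_def)

lemma sublinear_scale: "sublinear p \<Longrightarrow> t > 0 \<Longrightarrow> p (t *\<^sub>R x) = t * p x"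
  by (simp add: sublinear_def)

lemma sublinear_zero:
  assumes "sublinear p" shows "p 0 = 0"
  using sublinear_scale[OF assms, of 2 0] by simp

lemma sublinear_scale_nonneg: "sublinear p \<Longrightarrow> t \<ge> 0 \<Longrightarrow> p (t *\<^sub>R x) = t * p x"
  by (cases "t = 0") (simp_all add: sublinear_zero sublinear_scale)

lemma sublinear_neg_le:
  assumes "sublinear p" shows "- p (- x) \<le> p x"
  using sublinear_add[OF assms, of x "- x"] sublinear_zero[OF assms] by simp

text \<open>The largest sublinear functional \<open>r \<le> q\<close> with \<open>r (- a) \<le> - q a\<close>.\<close>

definition lower_along :: "'a::real_vector \<Rightarrow> ('a \<Rightarrow> real) \<Rightarrow> 'a \<Rightarrow> real" where
  "lower_along a q x = (INF t\<in>{0..}. q (x + t *\<^sub>R a) - t * q a)"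

lemma lower_along_le:
  assumes "sublinear q" "t \<ge> 0"
  shows "lower_along a q x \<le> q (x + t *\<^sub>R a) - t * q a"
  unfolding lower_along_def
proof (rule cINF_lower)
  show "bdd_below ((\<lambda>t. q (x + t *\<^sub>R a) - t * q a) ` {0..})"
  proof (rule bdd_belowI2)
    fix s :: real assume "s \<in> {0..}"
    \<comment> \<open>The bound is uniform in \<open>s\<close>:
      \<open>s * q a = q (s *\<^sub>R a)\<close>, and \<open>s *\<^sub>R a\<close> is the sum of
      \<open>x + s *\<^sub>R a\<close> and \<open>- x\<close>.\<close>
    then show "- q (- x) \<le> q (x + s *\<^sub>R a) - s * q a"
      using sublinear_add[OF assms(1), of "x + s *\<^sub>R a" "- x"]
        sublinear_scale_nonneg[OF assms(1), of s a] by simp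
  qed
qed (use assms in simp)

lemma lower_along_greatest:
  "(\<And>t. t \<ge> 0 \<Longrightarrow> m \<le> q (x + t *\<^sub>R a) - t * q a) \<Longrightarrow> m \<le> lower_along a q x"
  unfolding lower_along_def by (rule cINF_greatest) auto

lemma lower_along_below: "sublinear q \<Longrightarrow> lower_along a q x \<le> q x"
  using lower_along_le[of q 0 a x] by simp

lemma lower_along_uminus:
  assumes "sublinear q" shows "lower_along a q (- a) \<le> - q a"
  using lower_along_le[OF assms, of 1 a "- a"] sublinear_zero[OF assms] by simp

text \<open>Parameters \<open>s\<close> for \<open>x\<close> and \<open>t\<close> for
  \<open>y\<close> combine to \<open>s + t\<close> for \<open>x + y\<close>; scaling
  \<open>x\<close> by \<open>t\<close> turns a parameter \<open>s\<close> into
  \<open>t * s\<close>.\<close>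

lemma sublinear_lower_along:
  assumes q: "sublinear q"
  shows "sublinear (lower_along a q)"
proof (rule sublinearI)
  fix x y
  have *: "lower_along a q (x + y) \<le> (q (x + s *\<^sub>R a) - s * q a) + (q (y + t *\<^sub>R a) - t * q a)"
    if "s \<ge> 0" "t \<ge> 0" for s t
    using lower_along_le[OF q, of "s + t" a "x + y"] that
      sublinear_add[OF q, of "x + s *\<^sub>R a" "y + t *\<^sub>R a"]
    by (simp add: algebra_simps)
  have "lower_along a q (x + y) - (q (x + s *\<^sub>R a) - s * q a) \<le> lower_along a q y" if "s \<ge> 0" for s
    using *[OF that] by (intro lower_along_greatest) (simp add: algebra_simps)
  then have "lower_along a q (x + y) - lower_along a q y \<le> lower_along a q x"
    by (intro lower_along_greatest) (simp add: algebra_simps)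
  then show "lower_along a q (x + y) \<le> lower_along a q x + lower_along a q y"
    by simp
next
  fix x and t :: real
  assume t: "t > 0"
  have "lower_along a q (t *\<^sub>R x) / t \<le> lower_along a q x"
  proof (rule lower_along_greatest)
    fix s :: real
    assume s: "s \<ge> 0"
    have "lower_along a q (t *\<^sub>R x) \<le> q (t *\<^sub>R (x + s *\<^sub>R a)) - t * s * q a"
      using lower_along_le[OF q, of "t * s" a "t *\<^sub>R x"] s t by (simp add: scaleR_add_right)
    also have "\<dots> = t * (q (x + s *\<^sub>R a) - s * q a)"
      by (simp only: sublinear_scale[OF q t]) (simp add: algebra_simps)
    finally show "lower_along a q (t *\<^sub>R x) / t \<le> q (x + s *\<^sub>R a) - s * q a"
      using t by (simp add: field_simps)
  qed
  then show "lower_along a q (t *\<^sub>R x) \<le> t * lower_along a q x"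
    using t by (simp add: field_simps)
qed

text \<open>Minimality forces \<open>lower_along a q = q\<close> for every \<open>a\<close>; the
  parameter 1 then gives \<open>q x + q a \<le> q (x + a)\<close>, the converse of
  subadditivity.\<close>

lemma minimal_sublinear_imp_linear:
  assumes q: "sublinear q" and min: "\<And>r. sublinear r \<Longrightarrow> r \<le> q \<Longrightarrow> r = q"
  shows "linear q"
proof -
  have "lower_along a q = q" for a
    by (rule min) (auto simp: le_fun_def q sublinear_lower_along lower_along_below)
  then have "q x \<le> q (x + a) - q a" for x a
    using lower_along_le[OF q, of 1 a x] by simp
  then have add: "q (x + y) = q x + q y" for x y
    using sublinear_add[OF q, of x y] by (simp add: antisym algebra_simps)
  have neg: "q (- x) = - q x" for x
    using add[of x "- x"] sublinear_zero[OF q] by simp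
  have "q (t *\<^sub>R x) = t * q x" for t x
    using sublinear_scale_nonneg[OF q, of t x] sublinear_scale_nonneg[OF q, of "- t" x]
      neg[of "t *\<^sub>R x"] by (cases "t \<ge> 0") auto
  with add show ?thesis
    by (intro linearI) auto
qed

text \<open>Provides the bounds of chains for Zorn's lemma. Comparability enters in subadditivity:
  functionals nearly optimal at \<open>x\<close> and at \<open>y\<close> are replaced by the smaller
  of the two.\<close>

lemma sublinear_INF:
  assumes ne: "Q \<noteq> {}" and sub: "\<And>q. q \<in> Q \<Longrightarrow> sublinear q \<and> q \<le> p"
    and chain: "\<And>q r. q \<in> Q \<Longrightarrow> r \<in> Q \<Longrightarrow> q \<le> r \<or> r \<le> q"
  shows "sublinear (\<lambda>x. INF q\<in>Q. q x)" "q \<in> Q \<Longrightarrow> (\<lambda>x. INF q\<in>Q. q x) \<le> q"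
proof -
  \<comment> \<open>A real infimum needs a lower bound;
    \<open>- p (- x) \<le> - q (- x) \<le> q x\<close> gives one that is uniform in
    \<open>q\<close>.\<close>
  have bdd: "bdd_below ((\<lambda>q. q x) ` Q)" for x
  proof (rule bdd_belowI2)
    fix q assume "q \<in> Q"
    then have "sublinear q" "q (- x) \<le> p (- x)"
      using sub by (auto simp: le_fun_def)
    then show "- p (- x) \<le> q x"
      using sublinear_neg_le[of q x] by simp
  qed
  have lower: "(INF q\<in>Q. q x) \<le> q x" if "q \<in> Q" for q x
    by (rule cINF_lower[OF bdd that])
  then show "q \<in> Q \<Longrightarrow> (\<lambda>x. INF q\<in>Q. q x) \<le> q"
    by (simp add: le_fun_def)
  show "sublinear (\<lambda>x. INF q\<in>Q. q x)"
  proof (rule sublinearI)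
    fix x y
    have *: "(INF q\<in>Q. q (x + y)) \<le> q x + r y" if qr: "q \<in> Q" "r \<in> Q" for q r
    proof -
      from chain[OF qr] obtain s where s: "s \<in> Q" "s \<le> q" "s \<le> r"
        using qr by blast
      have "(INF q\<in>Q. q (x + y)) \<le> s (x + y)" by (rule lower[OF s(1)])
      also have "\<dots> \<le> s x + s y" using sub[OF s(1)] sublinear_add by blast
      also have "\<dots> \<le> q x + r y" using s(2,3) by (intro add_mono) (auto simp: le_fun_def)
      finally show ?thesis .
    qed
    have "(INF q\<in>Q. q (x + y)) - q x \<le> (INF q\<in>Q. q y)" if "q \<in> Q" for q
      using *[OF that] by (intro cINF_greatest[OF ne]) (simp add: algebra_simps)
    then have "(INF q\<in>Q. q (x + y)) - (INF q\<in>Q. q y) \<le> (INF q\<in>Q. q x)"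
      by (intro cINF_greatest[OF ne]) (simp add: algebra_simps)
    then show "(INF q\<in>Q. q (x + y)) \<le> (INF q\<in>Q. q x) + (INF q\<in>Q. q y)"
      by simp
  next
    fix x and t :: real
    assume t: "t > 0"
    have "(INF q\<in>Q. q (t *\<^sub>R x)) / t \<le> (INF q\<in>Q. q x)"
    proof (rule cINF_greatest[OF ne])
      fix q assume "q \<in> Q"
      then show "(INF q\<in>Q. q (t *\<^sub>R x)) / t \<le> q x"
        using lower[of q "t *\<^sub>R x"] sub[of q] t sublinear_scale[of q t x] by (simp add: field_simps)
    qed
    then show "(INF q\<in>Q. q (t *\<^sub>R x)) \<le> t * (INF q\<in>Q. q x)"
      using t by (simp add: field_simps)
  qed
qed

lemma linear_below_sublinear:
  assumes p: "sublinear p"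
  shows "\<exists>f. linear f \<and> f \<le> p"
proof -
  define A where "A = {q. sublinear q \<and> q \<le> p}"
  \<comment> \<open>Zorn's lemma yields maximal elements, so the pointwise order is
    reversed.\<close>
  have "\<exists>m\<in>A. \<forall>q\<in>A. q \<le> m \<longrightarrow> q = m"
  proof (rule predicate_Zorn[where P = "\<lambda>q r. r \<le> q"])
    show "partial_order_on A (relation_of (\<lambda>q r. r \<le> q) A)"
      by (rule partial_order_on_relation_ofI) auto
    fix Q assume Q: "Q \<in> Chains (relation_of (\<lambda>q r. r \<le> q) A)"
    show "\<exists>u\<in>A. \<forall>q\<in>Q. u \<le> q"
    \<comment> \<open>The infimum of an empty set of reals carries no information, so
      \<open>p\<close> itself bounds the empty chain.\<close>
    proof (cases "Q = {}")
      case True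
      then show ?thesis using p by (auto simp: A_def)
    next
      case False
      have sub: "\<And>q. q \<in> Q \<Longrightarrow> sublinear q \<and> q \<le> p"
        using Chains_relation_of[OF Q] by (auto simp: A_def)
      have chain: "\<And>q r. q \<in> Q \<Longrightarrow> r \<in> Q \<Longrightarrow> q \<le> r \<or> r \<le> q"
        using Q by (auto simp: Chains_def relation_of_def)
      have subl: "sublinear (\<lambda>x. INF q\<in>Q. q x)"
        by (rule sublinear_INF(1)[OF False sub chain])
      have lower: "\<And>q. q \<in> Q \<Longrightarrow> (\<lambda>x. INF q\<in>Q. q x) \<le> q"
        by (rule sublinear_INF(2)[OF False sub chain])
      obtain q where q: "q \<in> Q" using False by blast
      have "(\<lambda>x. INF q\<in>Q. q x) \<le> p"
        using order_trans[OF lower[OF q]] sub[OF q] by blast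
      with subl lower show ?thesis
        unfolding A_def by blast
    qed
  qed
  then obtain m where m: "m \<in> A" "\<And>q. q \<in> A \<Longrightarrow> q \<le> m \<Longrightarrow> q = m" by blast
  have "linear m"
  proof (rule minimal_sublinear_imp_linear)
    show "sublinear m" using m(1) by (simp add: A_def)
    \<comment> \<open>Minimality within \<open>A\<close> suffices, since whatever lies below
      \<open>m\<close> also lies below \<open>p\<close>.\<close>
    show "r = m" if "sublinear r" "r \<le> m" for r
      using m that by (auto simp: A_def)
  qed
  then show ?thesis using m(1) by (auto simp: A_def)
qed

text \<open>A linear \<open>f\<close> below \<open>lower_along a p\<close> satisfies
  \<open>- f a = f (- a) \<le> - p a\<close>, which forces it to touch \<open>p\<close> at
  \<open>a\<close>.\<close>

lemma Hahn_Banach_sublinear: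
  assumes p: "sublinear p"
  shows "\<exists>f. linear f \<and> f \<le> p \<and> f a = p a"
proof -
  obtain f where f: "linear f" "f \<le> lower_along a p"
    using linear_below_sublinear[OF sublinear_lower_along[OF p]] by blast
  have le: "f x \<le> lower_along a p x" for x
    using f(2) by (simp add: le_fun_def)
  have fp: "f x \<le> p x" for x
    using le[of x] lower_along_below[OF p, of a x] by simp
  have "p a \<le> f a"
    using le[of "- a"] lower_along_uminus[OF p, of a] linear_neg[OF f(1), of a] by simp
  with fp[of a] have "f a = p a" by simp
  with f(1) fp show ?thesis
    by (auto simp: le_fun_def)
qed

section \<open>The gauge of an absorbing convex set\<close>

definition minkowski_gauge :: "'a::real_vector set \<Rightarrow> 'a \<Rightarrow> real" where
  "minkowski_gauge W x = Inf {t. t > 0 \<and> (1 / t) *\<^sub>R x \<in> W}"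

text \<open>Exactly the non-emptiness of the sets whose infima define the gauge.\<close>

definition absorbing :: "'a::real_vector set \<Rightarrow> bool" where
  "absorbing W \<longleftrightarrow> (\<forall>x. \<exists>t>0. (1 / t) *\<^sub>R x \<in> W)"

lemma minkowski_gauge_le: "t > 0 \<Longrightarrow> (1 / t) *\<^sub>R x \<in> W \<Longrightarrow> minkowski_gauge W x \<le> t"
  unfolding minkowski_gauge_def by (rule cInf_lower) (auto intro!: bdd_belowI[of _ 0])

lemma minkowski_gauge_greatest:
  assumes "absorbing W" "\<And>t. t > 0 \<Longrightarrow> (1 / t) *\<^sub>R x \<in> W \<Longrightarrow> m \<le> t"
  shows "m \<le> minkowski_gauge W x"
  unfolding minkowski_gauge_def by (rule cInf_greatest) (use assms in \<open>auto simp: absorbing_def\<close>)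

text \<open>The vector \<open>(x + y) / (s + t)\<close> is the convex combination of
  \<open>x / s\<close> and \<open>y / t\<close> with weights \<open>s / (s + t)\<close> and
  \<open>t / (s + t)\<close>.\<close>

lemma sublinear_minkowski_gauge:
  assumes W: "convex W" "absorbing W"
  shows "sublinear (minkowski_gauge W)"
proof (rule sublinearI)
  fix x y
  have *: "minkowski_gauge W (x + y) \<le> s + t"
    if "s > 0" "(1 / s) *\<^sub>R x \<in> W" "t > 0" "(1 / t) *\<^sub>R y \<in> W" for s t
  proof (rule minkowski_gauge_le)
    have "(s / (s + t)) *\<^sub>R (1 / s) *\<^sub>R x + (t / (s + t)) *\<^sub>R (1 / t) *\<^sub>R y \<in> W"
      using that by (intro convexD[OF W(1)]) (auto simp: add_divide_distrib[symmetric])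
    then show "(1 / (s + t)) *\<^sub>R (x + y) \<in> W"
      using that by (simp add: scaleR_add_right)
  qed (use that in simp)
  have "minkowski_gauge W (x + y) - s \<le> minkowski_gauge W y" if "s > 0" "(1 / s) *\<^sub>R x \<in> W" for s
    using *[OF that] by (intro minkowski_gauge_greatest[OF W(2)]) (simp add: algebra_simps)
  then have "minkowski_gauge W (x + y) - minkowski_gauge W y \<le> minkowski_gauge W x"
    by (intro minkowski_gauge_greatest[OF W(2)]) (simp add: algebra_simps)
  then show "minkowski_gauge W (x + y) \<le> minkowski_gauge W x + minkowski_gauge W y" by simp
next
  fix x and t :: real
  assume t: "t > 0"
  have "minkowski_gauge W (t *\<^sub>R x) / t \<le> minkowski_gauge W x"
  proof (rule minkowski_gauge_greatest[OF W(2)])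
    fix s :: real assume "s > 0" "(1 / s) *\<^sub>R x \<in> W"
    then show "minkowski_gauge W (t *\<^sub>R x) / t \<le> s"
      using minkowski_gauge_le[of "t * s" "t *\<^sub>R x" W] t by (simp add: field_simps)
  qed
  then show "minkowski_gauge W (t *\<^sub>R x) \<le> t * minkowski_gauge W x"
    using t by (simp add: field_simps)
qed

lemma minkowski_gauge_le_1: "x \<in> W \<Longrightarrow> minkowski_gauge W x \<le> 1"
  by (rule minkowski_gauge_le) simp_all

text \<open>If \<open>x / t\<close> were in \<open>W\<close> for some \<open>t < 1\<close>, then
  \<open>x\<close>, lying on the segment from 0 to \<open>x / t\<close>, would be in
  \<open>W\<close>.\<close>

lemma minkowski_gauge_ge_1:
  assumes "convex W" "absorbing W" "0 \<in> W" "x \<notin> W"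
  shows "1 \<le> minkowski_gauge W x"
proof (rule minkowski_gauge_greatest[OF assms(2)])
  fix t :: real assume t: "t > 0" "(1 / t) *\<^sub>R x \<in> W"
  show "1 \<le> t"
  proof (rule ccontr)
    assume "\<not> 1 \<le> t"
    then have "t *\<^sub>R (1 / t) *\<^sub>R x + (1 - t) *\<^sub>R 0 \<in> W"
      using t assms by (intro convexD[OF assms(1)]) auto
    with t assms(4) show False by simp
  qed
qed

section \<open>Separation in locally convex spaces\<close>

text \<open>By continuity of scaling, \<open>t *\<^sub>R x\<close> tends to 0 as \<open>t\<close>
  decreases to 0, and so enters \<open>V\<close>.\<close>

lemma absorbing_nhd_zero:
  fixes V :: "'z::topological_real_vector set"
  assumes "open V" "0 \<in> V"
  shows "absorbing V"
  unfolding absorbing_def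
proof
  fix x :: 'z
  have "((\<lambda>t. t *\<^sub>R x) \<longlongrightarrow> 0 *\<^sub>R x) (at_right (0::real))"
    by (intro tendsto_scaleR' tendsto_const tendsto_ident_at)
  then have "\<forall>\<^sub>F t in at_right (0::real). t *\<^sub>R x \<in> V"
    using assms by (auto dest: topological_tendstoD)
  then have "\<forall>\<^sub>F t in at_right (0::real). t > 0 \<and> t *\<^sub>R x \<in> V"
    using eventually_at_right_less[of "0::real"] by (rule eventually_conj[rotated])
  then obtain t :: real where "t > 0" "t *\<^sub>R x \<in> V"
    using eventually_happens trivial_limit_at_right_real by blast
  then show "\<exists>t>0. (1 / t) *\<^sub>R x \<in> V"
    by (intro exI[of _ "1 / t"]) simp
qed

lemma absorbing_mono: "absorbing V \<Longrightarrow> V \<subseteq> W \<Longrightarrow> absorbing W"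
  unfolding absorbing_def by blast

lemma linear_bounded_above_nhd_imp_continuous:
  fixes f :: "'z::topological_real_vector \<Rightarrow> real"
  assumes f: "linear f" and V: "open V" "0 \<in> V" and le: "\<And>v. v \<in> V \<Longrightarrow> f v \<le> 1"
  shows "continuous_on UNIV f"
  unfolding continuous_on_def
proof
  fix x :: 'z
  show "(f \<longlongrightarrow> f x) (at x within UNIV)"
  proof (rule tendstoI)
    fix e :: real assume e: "e > 0"
    have ev: "\<forall>\<^sub>F y in at x within UNIV. (c / e) *\<^sub>R (y - x) \<in> V" for c
    proof -
      have "((\<lambda>y. (c / e) *\<^sub>R (y - x)) \<longlongrightarrow> (c / e) *\<^sub>R (x - x)) (at x within UNIV)"
        by (intro tendsto_scaleR' tendsto_const tendsto_diff tendsto_ident_at)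
      then show ?thesis using V by (auto dest: topological_tendstoD)
    qed
    show "\<forall>\<^sub>F y in at x within UNIV. dist (f y) (f x) < e"
      \<comment> \<open>Both signs are used because \<open>V\<close> need not be symmetric; the
        factor 2 bounds the difference by \<open>e / 2\<close> and so makes the inequality
        strict.\<close>
      using ev[of 2] ev[of "-2"]
    proof eventually_elim
      case (elim y)
      from elim[THEN le] have "2 * (f y - f x) \<le> e" "- 2 * (f y - f x) \<le> e"
        using e by (simp_all add: linear_scale[OF f] linear_diff[OF f] field_simps)
      with e show ?case by (simp add: dist_real_def abs_if)
    qed
  qed
qed

text \<open>With \<open>z + V\<close> disjoint from \<open>B\<close>, the convex set
  \<open>W = b0 - B + V\<close> is absorbing and misses \<open>b0 - z\<close>. A linear
  \<open>f\<close> that lies below the gauge of \<open>W\<close> and touches it at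
  \<open>b0 - z\<close> is at most 1 on \<open>W\<close> and at least 1 at \<open>b0 - z\<close>,
  hence separates.\<close>

lemma separation_point_closed_convex:
  fixes B :: "'z::locally_convex_space set"
  assumes "closed B" "convex B" "B \<noteq> {}" "z \<notin> B"
  obtains f r where "f \<in> top_dual" "f z < r" "\<And>b. b \<in> B \<Longrightarrow> r \<le> f b"
proof -
  have "open ((\<lambda>v. v + z) -` (- B))"
    using assms(1) continuous_on_add_right by (intro open_vimage) auto
  moreover have "0 \<in> (\<lambda>v. v + z) -` (- B)"
    using assms(4) by simp
  ultimately obtain V where V: "open V" "convex V" "0 \<in> V" "V \<subseteq> (\<lambda>v. v + z) -` (- B)"
    by (rule convex_nhds_zero)
  have disj: "v + z \<notin> B" if "v \<in> V" for v
    using V(4) that by auto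
  obtain b0 where b0: "b0 \<in> B" using assms(3) by blast
  define W where "W = (\<Union>b\<in>B. \<Union>v\<in>V. {(b0 - b) + v})"
  have W_I: "(b0 - b) + v \<in> W" if "b \<in> B" "v \<in> V" for b v
    using that by (auto simp: W_def)
  have "convex ((\<lambda>b. b0 - b) ` B)"
    using convex_translation[OF convex_negations[OF assms(2)], of b0] by (simp add: image_image)
  from convex_sums[OF this V(2)] have "convex W"
    by (simp only: W_def image_image)
  moreover have VW: "V \<subseteq> W"
    using W_I[OF b0] by auto
  moreover have "b0 - z \<notin> W"
  proof
    assume "b0 - z \<in> W"
    then obtain b v where bv: "b \<in> B" "v \<in> V" "b0 - z = b0 - b + v"
      by (auto simp: W_def)
    then have "v + z = b"
      by (simp add: algebra_simps)
    with disj[OF bv(2)] bv(1) show False by simp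
  qed
  ultimately have W: "convex W" "absorbing W" "0 \<in> W" "b0 - z \<notin> W"
    using V(3) absorbing_mono[OF absorbing_nhd_zero[OF V(1,3)]] by auto
  obtain f where f: "linear f" "f \<le> minkowski_gauge W" "f (b0 - z) = minkowski_gauge W (b0 - z)"
    using Hahn_Banach_sublinear[OF sublinear_minkowski_gauge[OF W(1,2)]] by blast
  have fW: "f w \<le> 1" if "w \<in> W" for w
    using f(2) minkowski_gauge_le_1[OF that] by (auto simp: le_fun_def intro: order_trans)
  have big: "f (b0 - z) \<ge> 1"
    using f(3) minkowski_gauge_ge_1[OF W] by simp
  \<comment> \<open>A positive multiple \<open>v\<close> of \<open>b0 - z\<close> inside
    \<open>V\<close> has \<open>f v > 0\<close>; this fixed amount is the gap between
    \<open>f z\<close> and the values on \<open>B\<close>.\<close>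
  obtain t where t: "t > 0" "(1 / t) *\<^sub>R (b0 - z) \<in> V"
    using absorbing_nhd_zero[OF V(1,3)] unfolding absorbing_def by blast
  define v where "v = (1 / t) *\<^sub>R (b0 - z)"
  have "f v > 0"
    using big t(1) by (simp add: v_def linear_scale[OF f(1)])
  moreover have "f z + f v \<le> f b" if "b \<in> B" for b
    using fW[OF W_I[OF that t(2)]] big
    by (simp add: v_def[symmetric] linear_add[OF f(1)] linear_diff[OF f(1)])
  moreover have "f \<in> top_dual"
    using f(1) linear_bounded_above_nhd_imp_continuous[OF f(1) V(1,3)] fW VW
    by (auto simp: top_dual_def)
  ultimately show thesis
    by (intro that[of f "f z + f v"]) auto
qed

section \<open>Support functions\<close>

text \<open>Since \<open>B\<close> contains \<open>b + C\<close>, a functional bounded below on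
  \<open>B\<close> cannot be negative on the cone \<open>C\<close>.\<close>

lemma separation_GG:
  fixes C :: "'z::locally_convex_space set"
  assumes C: "is_cone C" "0 \<in> C" and B: "B \<in> GG C" "B \<noteq> {}" "z \<notin> B"
  obtains f where "f \<in> dual_cone C - {\<lambda>_. 0}" "ereal (f z) < sigma_tri B f"
proof -
  have B': "closed B" "convex B" "B + C \<subseteq> B"
    using B(1) unfolding GG_iff[OF C(2)] by auto
  obtain f r where f: "f \<in> top_dual" "f z < r" "\<And>b. b \<in> B \<Longrightarrow> r \<le> f b"
    using separation_point_closed_convex[OF B'(1,2) B(2,3)] by blast
  have lin: "linear f" using f(1) by (simp add: top_dual_def)
  obtain b where b: "b \<in> B" using B(2) by blast
  have "f c \<ge> 0" if c: "c \<in> C" for c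
  proof (rule ccontr)
    assume "\<not> f c \<ge> 0"
    then have neg: "f c < 0" by simp
    have "r \<le> f b" using f(3) b by blast
    \<comment> \<open>Chosen so that \<open>f (b + t *\<^sub>R c) = r - 1\<close>, just below the
      bound \<open>r\<close>; the summand 1 also ensures \<open>t > 0\<close>.\<close>
    define t where "t = (f b - r + 1) / (- f c)"
    have "t > 0" using neg \<open>r \<le> f b\<close> by (simp add: t_def divide_pos_neg)
    then have "t *\<^sub>R c \<in> C" using C(1) c by (simp add: is_cone_def)
    then have "r \<le> f (b + t *\<^sub>R c)"
      using B'(3) b f(3) by blast
    also have "\<dots> = f b + t * f c"
      by (simp add: linear_add[OF lin] linear_scale[OF lin])
    also have "\<dots> = r - 1"
      using neg by (simp add: t_def field_simps)
    finally show False by simp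
  qed
  moreover have "f \<noteq> (\<lambda>_. 0)" using f(2) f(3)[OF b] by auto
  moreover have "ereal r \<le> sigma_tri B f"
    unfolding sigma_tri_def using f(3) by (intro INF_greatest) simp
  then have "ereal (f z) < sigma_tri B f"
    using f(2) by (meson ereal_less_le less_ereal.simps(1) order_less_le_trans)
  ultimately show thesis
    using f(1) by (intro that) (auto simp: dual_cone_def)
qed

text \<open>The set where \<open>f\<close> is at least \<open>sigma_tri S f\<close> is closed,
  convex and contains \<open>S\<close>, hence contains the closed convex hull.\<close>

lemma sigma_tri_closure_convex_hull:
  assumes "f \<in> top_dual"
  shows "sigma_tri (closure (convex hull S)) f = sigma_tri S f"
proof (rule antisym)
  have lin: "linear f" and cont: "continuous_on UNIV f"
    using assms by (auto simp: top_dual_def)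
  show "sigma_tri (closure (convex hull S)) f \<le> sigma_tri S f"
    unfolding sigma_tri_def
    by (rule INF_superset_mono[OF order_trans[OF hull_subset closure_subset] order_refl])
  define H where "H = {x. sigma_tri S f \<le> ereal (f x)}"
  \<comment> \<open>The three cases are the values plus infinity, minus infinity and a real
    \<open>r\<close>.\<close>
  have H: "H = {} \<or> H = UNIV \<or> (\<exists>r. H = {x. r \<le> f x})"
    unfolding H_def by (cases "sigma_tri S f") auto
  have "closed {x. r \<le> f x}" for r
    using cont by (intro closed_Collect_le) auto
  moreover have "convex {x. r \<le> f x}" for r
    using convex_linear_vimage[OF lin convex_real_interval(1)[of r]]
    by (simp add: vimage_def)
  ultimately have "closed H" "convex H" using H by auto
  moreover have "S \<subseteq> H"
    by (auto simp: H_def sigma_tri_def intro: INF_lower)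
  ultimately have "closure (convex hull S) \<subseteq> H"
    by (intro closure_minimal hull_minimal)
  then show "sigma_tri S f \<le> sigma_tri (closure (convex hull S)) f"
    unfolding sigma_tri_def[of "closure _"] by (intro INF_greatest) (auto simp: H_def)
qed

lemma sigma_tri_G_inf:
  assumes "f \<in> top_dual"
  shows "sigma_tri (G_inf \<A>) f = (INF A\<in>\<A>. sigma_tri A f)"
  unfolding G_inf_def sigma_tri_closure_convex_hull[OF assms]
  unfolding sigma_tri_def by (rule antisym) (auto intro!: INF_greatest intro: INF_lower INF_lower2)

lemma GG_eq_Inter_halfspaces:
  fixes C :: "'z::locally_convex_space set"
  assumes C: "is_cone C" "0 \<in> C" and ne: "dual_cone C - {\<lambda>_. 0} \<noteq> {}" and B: "B \<in> GG C"
  shows "B = (\<Inter>f \<in> dual_cone C - {\<lambda>_. 0}. {z. sigma_tri B f \<le> ereal (f z)})"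
proof (cases "B = {}")
  case True
  \<comment> \<open>For empty \<open>B\<close> every half-space is empty, but an intersection over
    no functionals would be the whole space; \<open>ne\<close> excludes this.\<close>
  with ne show ?thesis by (auto simp: sigma_tri_def top_ereal_def)
next
  case False
  show ?thesis
  proof (rule subset_antisym)
    show "B \<subseteq> (\<Inter>f \<in> dual_cone C - {\<lambda>_. 0}. {z. sigma_tri B f \<le> ereal (f z)})"
      by (auto simp: sigma_tri_def intro: INF_lower)
    show "(\<Inter>f \<in> dual_cone C - {\<lambda>_. 0}. {z. sigma_tri B f \<le> ereal (f z)}) \<subseteq> B"
    proof
      fix z assume z: "z \<in> (\<Inter>f \<in> dual_cone C - {\<lambda>_. 0}. {z. sigma_tri B f \<le> ereal (f z)})"
      show "z \<in> B"
      proof (rule ccontr)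
        assume "z \<notin> B"
        then obtain f where "f \<in> dual_cone C - {\<lambda>_. 0}" "ereal (f z) < sigma_tri B f"
          using separation_GG[OF C B False] by blast
        with z show False by force
      qed
    qed
  qed
qed

text \<open>The two representations are guarded because a dense cone \<open>C\<close> has only the
  zero functional in \<open>dual_cone C\<close>. The intersections are then the whole space, whereas
  \<open>G_inf {}\<close> and \<open>G_sup {{}}\<close> are empty.\<close>

theorem lemma4p14:
  fixes C :: "'z::locally_convex_space set" and \<A> :: "'z set set"
  assumes "\<exists>z::'z. z \<noteq> 0"
    and "is_cone C" and "convex C" and "0 \<in> C" and "C \<noteq> UNIV"
    and "\<A> \<subseteq> GG C"
  shows "(\<forall>f \<in> dual_cone C - {\<lambda>_. 0}. sigma_tri (G_inf \<A>) f = (INF A\<in>\<A>. sigma_tri A f)) \<and>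
    (\<forall>f \<in> dual_cone C - {\<lambda>_. 0}. sigma_tri (G_sup \<A>) f \<ge> (SUP A\<in>\<A>. sigma_tri A f)) \<and>
    (dual_cone C - {\<lambda>_. 0} \<noteq> {} \<longrightarrow>
      G_inf \<A> = (\<Inter>f \<in> dual_cone C - {\<lambda>_. 0}. {z. (INF A\<in>\<A>. sigma_tri A f) \<le> ereal (f z)}) \<and>
      G_sup \<A> = (\<Inter>f \<in> dual_cone C - {\<lambda>_. 0}. {z. (SUP A\<in>\<A>. sigma_tri A f) \<le> ereal (f z)}))"
proof (intro conjI impI ballI)
  note C = \<open>is_cone C\<close> \<open>0 \<in> C\<close>
  have dual: "f \<in> top_dual" if "f \<in> dual_cone C - {\<lambda>_. 0}" for f
    using that by (simp add: dual_cone_def)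
  show "sigma_tri (G_inf \<A>) f = (INF A\<in>\<A>. sigma_tri A f)" if "f \<in> dual_cone C - {\<lambda>_. 0}" for f
    by (rule sigma_tri_G_inf[OF dual[OF that]])
  show "sigma_tri (G_sup \<A>) f \<ge> (SUP A\<in>\<A>. sigma_tri A f)" for f
    unfolding sigma_tri_def G_sup_def by (intro SUP_least INF_superset_mono) auto
  assume ne: "dual_cone C - {\<lambda>_. 0} \<noteq> {}"
  show "G_inf \<A> = (\<Inter>f \<in> dual_cone C - {\<lambda>_. 0}. {z. (INF A\<in>\<A>. sigma_tri A f) \<le> ereal (f z)})"
    by (subst GG_eq_Inter_halfspaces[OF C ne G_inf_glb(1)[OF C(2) \<open>\<A> \<subseteq> GG C\<close>]])
      (intro INF_cong refl, simp only: sigma_tri_G_inf[OF dual])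
  \<comment> \<open>Each member of the family is represented separately and the intersections are
    swapped: \<open>sigma_tri\<close> of \<open>G_sup\<close> is only bounded below by the supremum,
    so representing \<open>G_sup\<close> itself would not give the formula directly.\<close>
  have "G_sup \<A> = (\<Inter>A\<in>\<A>. \<Inter>f \<in> dual_cone C - {\<lambda>_. 0}. {z. sigma_tri A f \<le> ereal (f z)})"
    unfolding G_sup_def using GG_eq_Inter_halfspaces[OF C ne] \<open>\<A> \<subseteq> GG C\<close> by blast
  then show "G_sup \<A> = (\<Inter>f \<in> dual_cone C - {\<lambda>_. 0}. {z. (SUP A\<in>\<A>. sigma_tri A f) \<le> ereal (f z)})"
    by (auto simp: SUP_le_iff)
qed

end
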